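(* Let $n\geq 3$. Then $\kappa_2(L_2(n))=2k-\lambda-2=3n-4$, where $k=2(n-1)$ and $\lambda=n-2$. Moreover, the only disconnecting sets $S$ of $L_2(n)$ of size $3n-4$ such that every component of $L_2(n)\setminus S$ has at least two vertices are the sets $N(\{u,v\})$, where $u,v\in V(L_2(n))$ are adjacent, and, for $n=4$, also (modulo a permutation of the values of the first coordinate and a permutation of the values of the second coordinate) the set $\{13,14,23,24,32,31,42,41\}$.
   Context: The lattice graph $L_2(n)$ has vertex set $[n]\times[n]=\{ab:1\leq a,b\leq n\}$ (where $ab$ denotes the ordered pair $(a,b)$), with distinct vertices $ab$ and $xy$ adjacent if and only if $a=x$ or $b=y$. It is $k$-regular with $k=2(n-1)$, and any two adjacent vertices have exactly $\lambda=n-2$ common neighbors. For a graph $G$ and $X\subset V(G)$, $N(X)=\{y\notin X: y\sim x\text{ for some }x\in X\}$. A disconnecting set of a connected graph $G$ is a set $S$ of vertices such that $G\setminus S$ is disconnected. $\kappa_2(G)$ denotes the minimum size of a disconnecting set $S$ of $G$ such that every component of $G\setminus S$ has at least two vertices. *)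

theory Defs
  imports "Graph_Theory.Graph_Theory" "HOL-Combinatorics.Permutations"
begin

(* Simple graphs are the symmetric, loop-free, finite digraphs without parallel arcs
   of the locale graph; an undirected edge is a pair of opposite arcs. *)
definition lattice_graph :: "nat \<Rightarrow> (nat \<times> nat) pair_pre_digraph" where
  "lattice_graph n = \<lparr> pverts = {1..n} \<times> {1..n},
     parcs = {((a, b), (x, y)) | a b x y.
       a \<in> {1..n} \<and> b \<in> {1..n} \<and> x \<in> {1..n} \<and> y \<in> {1..n} \<and>
       (a, b) \<noteq> (x, y) \<and> (a = x \<or> b = y)} \<rparr>"

definition neighbourhood :: "('a, 'b) pre_digraph \<Rightarrow> 'a set \<Rightarrow> 'a set" where
  "neighbourhood G X = {y \<in> verts G. y \<notin> X \<and> (\<exists>x \<in> X. y \<rightarrow>\<^bsub>G\<^esub> x)}"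

definition delete_verts :: "('a, 'b) pre_digraph \<Rightarrow> 'a set \<Rightarrow> ('a, 'b) pre_digraph" where
  "delete_verts G S = G \<restriction> (verts G - S)"

(* The null graph does not count as connected in the library. The strict inclusion
   keeps S = verts G from being a disconnecting set. *)
definition disconnecting_set :: "('a, 'b) pre_digraph \<Rightarrow> 'a set \<Rightarrow> bool" where
  "disconnecting_set G S \<longleftrightarrow> S \<subset> verts G \<and> \<not> connected (delete_verts G S)"

(* In a symmetric digraph the strongly connected components (sccs) are the
   connected components of the undirected graph. *)
definition disconnecting_set2 :: "('a, 'b) pre_digraph \<Rightarrow> 'a set \<Rightarrow> bool" where
  "disconnecting_set2 G S \<longleftrightarrow> disconnecting_set G S \<and>
     (\<forall>C \<in> pre_digraph.sccs (delete_verts G S). card (verts C) \<ge> 2)"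

(* Meaningful for finite connected G that have such a set; otherwise LEAST is arbitrary. *)
definition kappa2 :: "('a, 'b) pre_digraph \<Rightarrow> nat" where
  "kappa2 G = (LEAST m. \<exists>S. disconnecting_set2 G S \<and> card S = m)"

lemma graph_lattice_graph: "graph (lattice_graph n)"
proof -
  have fin: "finite (parcs (lattice_graph n))"
    by (rule finite_subset[of _ "({1..n} \<times> {1..n}) \<times> ({1..n} \<times> {1..n})"])
      (auto simp: lattice_graph_def)
  show ?thesis
    using fin
    by unfold_locales
      (auto simp: lattice_graph_def symmetric_def arc_to_ends_def intro!: symI)
qed

lemma connected_lattice_graph:
  assumes "n \<ge> 1"
  shows "connected (lattice_graph n)"
proof -
  interpret graph "with_proj (lattice_graph n)" by (rule graph_lattice_graph)
  show ?thesis
  proof (rule connectedI)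
    show "verts (lattice_graph n) \<noteq> {}"
      using assms by (auto simp: lattice_graph_def)
  next
    fix u v assume uv: "u \<in> verts (lattice_graph n)" "v \<in> verts (lattice_graph n)"
    define w where "w = (fst u, snd v)"
    have w: "w \<in> verts (lattice_graph n)"
      using uv by (auto simp: lattice_graph_def w_def)
    have "u = w \<or> u \<rightarrow>\<^bsub>lattice_graph n\<^esub> w" "w = v \<or> w \<rightarrow>\<^bsub>lattice_graph n\<^esub> v"
      using uv by (auto simp: lattice_graph_def w_def prod_eq_iff)
    then have "u \<rightarrow>\<^sup>*\<^bsub>lattice_graph n\<^esub> w" "w \<rightarrow>\<^sup>*\<^bsub>lattice_graph n\<^esub> v"
      using uv w by (auto intro: reachable_adjI)
    then have "u \<rightarrow>\<^sup>*\<^bsub>lattice_graph n\<^esub> v" by (rule reachable_trans)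
    then show "u \<rightarrow>\<^sup>*\<^bsub>mk_symmetric (lattice_graph n)\<^esub> v" by (rule reachable_mk_symmetricI)
  qed
qed

end

theory Submission
  imports Defs
begin

text \<open>
  Adjacent cells share a row or a column, so distinct components of \<open>L\<^sub>2(n) - S\<close> use disjoint sets
  of rows and disjoint sets of columns. If a component uses the rows \<open>R\<close> and the columns \<open>D\<close>, then
  \<open>S\<close> contains every cell lying in exactly one of a row of \<open>R\<close> and a column of \<open>D\<close>. With
  \<open>a = |R|\<close> and \<open>b = |D|\<close> there are \<open>a(n - b) + (n - a)b\<close> of them, and twice this number equals
  \<open>st + (a - b)\<^sup>2\<close> for \<open>s = a + b\<close>, \<open>t = 2n - s\<close>. Components with at least two cells force
  \<open>s, t \<ge> 3\<close>, hence the bound \<open>3n - 4\<close>, attained only if \<open>{a, b} = {1, 2}\<close>, or the same holds for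
  the complementary rows and columns, or \<open>a = b = 2\<close> and \<open>n = 4\<close>.
\<close>

section \<open>Vertex deletion, connectivity and components in symmetric digraphs\<close>

lemma graph_delete_verts:
  assumes "graph G"
  shows "graph (delete_verts G S)"
proof -
  interpret graph G by fact
  have "induced_subgraph (delete_verts G S) G"
    unfolding delete_verts_def by (rule induced_induce) auto
  then show ?thesis
    by (intro graph.intro pseudo_graph.intro digraphI_induced induced_graph_imp_graph
        digraph.axioms(1))
qed

lemma verts_delete_verts [simp]: "verts (delete_verts G S) = verts G - S"
  by (simp add: delete_verts_def)

lemma dominates_delete_verts:
  "u \<rightarrow>\<^bsub>delete_verts G S\<^esub> v \<longleftrightarrow> u \<in> verts G - S \<and> v \<in> verts G - S \<and> u \<rightarrow>\<^bsub>G\<^esub> v"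
  by (auto simp: delete_verts_def induce_subgraph_def arcs_ends_def arc_to_ends_def)

text \<open>\<open>connected\<close> refers to the symmetric closure, and taking this closure does
  not change reachability when the arcs are already symmetric.\<close>

lemma (in sym_digraph) connected_iff_strongly_connected:
  "connected G \<longleftrightarrow> strongly_connected G"
  by (auto simp: connected_def strongly_connected_def reachable_mk_symmetric_eq[OF sym_arcs])

text \<open>The set of vertices reachable from one vertex is closed under arcs, and no walk leaves a
  closed set. This trades reachability for a condition on single arcs, which can be read off in the
  lattice graph.\<close>

lemma (in sym_digraph) not_connected_iff_closed:
  assumes "verts G \<noteq> {}"
  shows "\<not> connected G \<longleftrightarrow>
    (\<exists>C. C \<noteq> {} \<and> C \<subset> verts G \<and> (\<forall>u \<in> C. \<forall>v. u \<rightarrow>\<^bsub>G\<^esub> v \<longrightarrow> v \<in> C))"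
proof
  assume "\<not> connected G"
  then obtain u v where uv: "u \<in> verts G" "v \<in> verts G" "\<not> u \<rightarrow>\<^sup>* v"
    using assms by (auto simp: connected_iff_strongly_connected strongly_connected_def)
  let ?C = "{w. u \<rightarrow>\<^sup>* w}"
  have "u \<in> ?C" "v \<notin> ?C" "?C \<subseteq> verts G"
    using uv by (auto dest: reachable_in_verts)
  then have "?C \<noteq> {}" "?C \<subset> verts G"
    using uv(2) by blast+
  moreover have "\<forall>w \<in> ?C. \<forall>x. w \<rightarrow>\<^bsub>G\<^esub> x \<longrightarrow> x \<in> ?C"
    by (metis mem_Collect_eq reachable_adj_trans)
  ultimately show "\<exists>C. C \<noteq> {} \<and> C \<subset> verts G \<and> (\<forall>u \<in> C. \<forall>v. u \<rightarrow>\<^bsub>G\<^esub> v \<longrightarrow> v \<in> C)"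
    by (intro exI[of _ ?C] conjI)
next
  assume "\<exists>C. C \<noteq> {} \<and> C \<subset> verts G \<and> (\<forall>u \<in> C. \<forall>v. u \<rightarrow>\<^bsub>G\<^esub> v \<longrightarrow> v \<in> C)"
  then obtain C where "C \<noteq> {}" "C \<subset> verts G"
    and C: "\<forall>u \<in> C. \<forall>v. u \<rightarrow>\<^bsub>G\<^esub> v \<longrightarrow> v \<in> C"
    by (elim exE conjE)
  then obtain u v where uv: "u \<in> C" "u \<in> verts G" "v \<in> verts G" "v \<notin> C"
    by blast
  have "w \<in> C" if "u \<rightarrow>\<^sup>* w" for w
    using that
  proof (induction rule: reachable_induct)
    case base
    show ?case by (rule uv)
  next
    case (step x y)
    then show ?case using C by blast
  qed
  with uv(4) have "\<not> u \<rightarrow>\<^sup>* v" by blast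
  with uv(2,3) show "\<not> connected G"
    unfolding connected_iff_strongly_connected strongly_connected_def by blast
qed

text \<open>The first arc of a walk from \<open>u\<close> to another vertex of its component leads
  to a neighbour. Conversely, a neighbour lies in the same component because arcs can be
  reversed.\<close>

lemma (in graph) card_sccs_ge_2_iff:
  "(\<forall>C \<in> sccs. card (verts C) \<ge> 2) \<longleftrightarrow> (\<forall>u \<in> verts G. \<exists>v. u \<rightarrow>\<^bsub>G\<^esub> v)"
proof
  assume L: "\<forall>C \<in> sccs. card (verts C) \<ge> 2"
  show "\<forall>u \<in> verts G. \<exists>v. u \<rightarrow>\<^bsub>G\<^esub> v"
  proof
    fix u assume u: "u \<in> verts G"
    have "G \<restriction> scc_of u \<in> sccs"
      using scc_of_in_sccs_verts[OF u] by (simp add: in_sccs_verts_conv)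
    with L have "card (scc_of u) \<ge> 2" by fastforce
    then have "\<not> scc_of u \<subseteq> {u}"
      using card_mono[of "{u}" "scc_of u"] by auto
    then obtain w where "u \<rightarrow>\<^sup>* w" "w \<noteq> u"
      by (auto simp: scc_of_def)
    then show "\<exists>v. u \<rightarrow>\<^bsub>G\<^esub> v"
      by (metis converse_reachable_cases)
  qed
next
  assume R: "\<forall>u \<in> verts G. \<exists>v. u \<rightarrow>\<^bsub>G\<^esub> v"
  show "\<forall>C \<in> sccs. card (verts C) \<ge> 2"
  proof
    fix C assume "C \<in> sccs"
    then have "verts C \<in> sccs_verts" by (simp add: sccs_verts_conv)
    then obtain u where u: "u \<in> verts G" and C: "verts C = scc_of u"
      by (auto simp: sccs_verts_conv_scc_of)
    obtain v where v: "u \<rightarrow>\<^bsub>G\<^esub> v" using R u by blast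
    then have "u \<noteq> v" by (metis adj_not_same)
    moreover have "{u, v} \<subseteq> scc_of u"
      using u v by (auto simp: scc_of_def intro: reachable_adjI symmetric_reachable[OF sym_arcs])
    moreover have "finite (scc_of u)"
      by (rule finite_subset[of _ "verts G"]) (auto simp: scc_of_def dest: reachable_in_verts)
    ultimately show "card (verts C) \<ge> 2"
      using card_mono[of "scc_of u" "{u, v}"] C by simp
  qed
qed

text \<open>This removes the deleted graph and its components, leaving only arcs of
  \<open>G\<close>. The inclusion of \<open>S\<close> need not be strict on the right, since a
  non-empty \<open>C\<close> already leaves a vertex outside \<open>S\<close>.\<close>

lemma disconnecting_set2_iff:
  assumes "graph G"
  shows "disconnecting_set2 G S \<longleftrightarrow> S \<subseteq> verts G \<and>
    (\<exists>C. C \<noteq> {} \<and> C \<subset> verts G - S \<and> (\<forall>u \<in> C. \<forall>v \<in> verts G - S. u \<rightarrow>\<^bsub>G\<^esub> v \<longrightarrow> v \<in> C)) \<and>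
    (\<forall>u \<in> verts G - S. \<exists>v \<in> verts G - S. u \<rightarrow>\<^bsub>G\<^esub> v)"
proof (cases "S \<subset> verts G")
  case True
  interpret H: graph "delete_verts G S" by (rule graph_delete_verts) fact
  have nonempty: "verts (delete_verts G S) \<noteq> {}" using True by auto
  have "\<not> connected (delete_verts G S) \<longleftrightarrow>
      (\<exists>C. C \<noteq> {} \<and> C \<subset> verts G - S \<and>
        (\<forall>u \<in> C. \<forall>v \<in> verts G - S. u \<rightarrow>\<^bsub>G\<^esub> v \<longrightarrow> v \<in> C))"
    unfolding H.not_connected_iff_closed[OF nonempty] verts_delete_verts dominates_delete_verts
    by (intro ex_cong1) blast
  moreover have "(\<forall>C \<in> H.sccs. card (verts C) \<ge> 2) \<longleftrightarrow>
      (\<forall>u \<in> verts G - S. \<exists>v \<in> verts G - S. u \<rightarrow>\<^bsub>G\<^esub> v)"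
    unfolding H.card_sccs_ge_2_iff verts_delete_verts dominates_delete_verts by blast
  ultimately show ?thesis
    using True by (simp add: disconnecting_set2_def disconnecting_set_def psubset_imp_subset)
next
  case False
  then show ?thesis
    by (auto simp: disconnecting_set2_def disconnecting_set_def)
qed

section \<open>Crosses of rows and columns, and adjacency in the lattice graph\<close>

definition cross :: "'a set \<Rightarrow> 'b set \<Rightarrow> 'a set \<Rightarrow> 'b set \<Rightarrow> ('a \<times> 'b) set" where
  "cross A B R D = R \<times> (B - D) \<union> (A - R) \<times> D"

text \<open>The two parts of the union swap roles. Hence an extremal pair \<open>(R, D)\<close> may
  be replaced by the complementary pair.\<close>

lemma cross_compl:
  assumes "R \<subseteq> A" "D \<subseteq> B"
  shows "cross A B (A - R) (B - D) = cross A B R D"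
  using assms by (auto simp: cross_def)

lemma card_cross:
  assumes "finite A" "finite B" "R \<subseteq> A" "D \<subseteq> B"
  shows "card (cross A B R D) = card R * (card B - card D) + (card A - card R) * card D"
proof -
  have fin: "finite R" "finite D" using assms finite_subset by blast+
  have "R \<times> (B - D) \<inter> (A - R) \<times> D = {}" by auto
  then show ?thesis
    unfolding cross_def using assms fin
    by (subst card_Un_disjoint) (auto simp: card_cartesian_product card_Diff_subset)
qed

text \<open>Bijections carry complements to complements. This is used to move the exceptional set
  for \<open>n = 4\<close>.\<close>

lemma map_prod_image_cross:
  assumes "bij_betw f A A'" "bij_betw g B B'" "R \<subseteq> A" "D \<subseteq> B"
  shows "map_prod f g ` cross A B R D = cross A' B' (f ` R) (g ` D)"
proof -
  have "f ` (A - R) = A' - f ` R" "g ` (B - D) = B' - g ` D"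
    using assms inj_on_image_set_diff[of f A A R] inj_on_image_set_diff[of g B B D]
    by (simp_all add: bij_betw_def)
  then show ?thesis
    by (simp add: cross_def image_Un map_prod_surj_on[OF refl refl])
qed

text \<open>The inclusions and non-emptiness make both \<open>R \<times> D\<close> and the
  complementary rectangle non-empty. The two inequalities then give each of them at least two cells;
  the second is written additively to avoid truncated subtraction.\<close>

definition admissible :: "nat \<Rightarrow> nat set \<Rightarrow> nat set \<Rightarrow> bool" where
  "admissible n R D \<longleftrightarrow> R \<subset> {1..n} \<and> D \<subset> {1..n} \<and> R \<noteq> {} \<and> D \<noteq> {} \<and>
     3 \<le> card R + card D \<and> card R + card D + 3 \<le> 2 * n"

lemma pverts_lattice_graph [simp]: "pverts (lattice_graph n) = {1..n} \<times> {1..n}"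
  by (simp add: lattice_graph_def)

lemma verts_lattice_graph: "verts (lattice_graph n) = {1..n} \<times> {1..n}"
  by simp

lemma parcs_lattice_graph_iff:
  "(u, v) \<in> parcs (lattice_graph n) \<longleftrightarrow>
    u \<in> {1..n} \<times> {1..n} \<and> v \<in> {1..n} \<times> {1..n} \<and> u \<noteq> v \<and> (fst u = fst v \<or> snd u = snd v)"
  by (cases u; cases v) (auto simp: lattice_graph_def)

lemma dominates_lattice_graph:
  "u \<rightarrow>\<^bsub>lattice_graph n\<^esub> v \<longleftrightarrow>
    u \<in> {1..n} \<times> {1..n} \<and> v \<in> {1..n} \<times> {1..n} \<and> u \<noteq> v \<and> (fst u = fst v \<or> snd u = snd v)"
  by (simp only: with_proj_simps parcs_lattice_graph_iff)

section \<open>From disconnecting sets to crosses\<close>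

lemma finite_disconnecting_set2_lattice_graph:
  assumes "disconnecting_set2 (lattice_graph n) S"
  shows "finite S"
proof (rule finite_subset)
  show "S \<subseteq> {1..n} \<times> {1..n}"
    using assms by (simp add: disconnecting_set2_def disconnecting_set_def psubset_imp_subset)
qed simp

text \<open>Distinct cells differ in some coordinate, so one projection has two values and the other
  at least one.\<close>

lemma card_fst_snd_ge_3:
  assumes "u \<noteq> v" "{u, v} \<subseteq> R \<times> D" "finite R" "finite D"
  shows "3 \<le> card R + card D"
proof -
  have "card {fst u, fst v} \<le> card R" "card {snd u, snd v} \<le> card D"
    using assms by (auto intro!: card_mono)
  moreover have "3 \<le> card {fst u, fst v} + card {snd u, snd v}"
    using assms(1) by (auto simp: prod_eq_iff card_insert_if)
  ultimately show ?thesis by linarith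
qed

text \<open>For a closed set \<open>C\<close> of remaining cells, take \<open>R = fst\<close>
  C\<open>and\<close>D = snd \<open>C\<close>. A remaining cell in a row or column used by
  \<open>C\<close> equals or is adjacent to a cell of \<open>C\<close>, so it belongs to
  \<open>C\<close>.\<close>

lemma disconnecting_set2_superset_cross:
  assumes "disconnecting_set2 (lattice_graph n) S"
  obtains R D where "admissible n R D" "cross {1..n} {1..n} R D \<subseteq> S"
proof -
  let ?V = "{1..n} \<times> {1..n}"
  have "S \<subseteq> ?V \<and>
    (\<exists>C. C \<noteq> {} \<and> C \<subset> ?V - S \<and>
      (\<forall>u \<in> C. \<forall>v \<in> ?V - S. u \<rightarrow>\<^bsub>lattice_graph n\<^esub> v \<longrightarrow> v \<in> C)) \<and>
    (\<forall>u \<in> ?V - S. \<exists>v \<in> ?V - S. u \<rightarrow>\<^bsub>lattice_graph n\<^esub> v)"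
    using assms unfolding disconnecting_set2_iff[OF graph_lattice_graph] verts_lattice_graph .
  then obtain C where C: "C \<noteq> {}" "C \<subset> ?V - S"
    and closed: "\<forall>u \<in> C. \<forall>v \<in> ?V - S. u \<rightarrow>\<^bsub>lattice_graph n\<^esub> v \<longrightarrow> v \<in> C"
    and neighbour: "\<forall>u \<in> ?V - S. \<exists>v \<in> ?V - S. u \<rightarrow>\<^bsub>lattice_graph n\<^esub> v"
    by (elim conjE exE)
  have closed': "v \<in> C" if v: "v \<in> ?V - S" "fst v \<in> fst ` C \<or> snd v \<in> snd ` C" for v
  proof -
    obtain u where u: "u \<in> C" "fst u = fst v \<or> snd u = snd v"
      using v(2) by force
    then have "u = v \<or> u \<rightarrow>\<^bsub>lattice_graph n\<^esub> v"
      using v(1) C(2) unfolding dominates_lattice_graph by blast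
    then show ?thesis using u(1) v(1) closed by metis
  qed
  \<comment> \<open>The remaining cells outside \<open>C\<close> avoid all rows and columns of
    \<open>C\<close>; this supplies the bound for the complementary rectangle.\<close>
  have outside: "v \<in> ({1..n} - fst ` C) \<times> ({1..n} - snd ` C)" if "v \<in> ?V - S - C" for v
    using that closed'[of v] by (cases v) auto
  have sub: "fst ` C \<subseteq> {1..n}" "snd ` C \<subseteq> {1..n}" using C by auto
  then have fin: "finite (fst ` C)" "finite (snd ` C)" by (auto intro: finite_subset)
  obtain u where u: "u \<in> C" using C by blast
  moreover obtain u' where u': "u' \<in> ?V - S" "u \<rightarrow>\<^bsub>lattice_graph n\<^esub> u'"
    using neighbour u C by blast
  ultimately have "u' \<in> C" "u \<noteq> u'"
    using closed unfolding dominates_lattice_graph by blast+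
  with u have inside: "3 \<le> card (fst ` C) + card (snd ` C)"
    by (intro card_fst_snd_ge_3[of u u'] fin) (auto simp: mem_Times_iff)
  obtain w where w: "w \<in> ?V - S - C" using C by blast
  moreover obtain w' where w': "w' \<in> ?V - S" "w \<rightarrow>\<^bsub>lattice_graph n\<^esub> w'"
    using neighbour w by blast
  \<comment> \<open>Closedness is applied in the reverse direction: if \<open>w'\<close> were in
    \<open>C\<close>, so would be \<open>w\<close>.\<close>
  moreover have "w' \<rightarrow>\<^bsub>lattice_graph n\<^esub> w"
    using w'(2) unfolding dominates_lattice_graph by auto
  ultimately have "w' \<notin> C" "w \<noteq> w'"
    using closed unfolding dominates_lattice_graph by blast+
  then have "3 \<le> card ({1..n} - fst ` C) + card ({1..n} - snd ` C)"
    using outside[of w] outside[of w'] w w'(1)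
    by (intro card_fst_snd_ge_3[of w w']) auto
  moreover have "card (fst ` C) \<le> n" "card (snd ` C) \<le> n"
    using sub card_mono[of "{1..n}"] by fastforce+
  ultimately have "card (fst ` C) + card (snd ` C) + 3 \<le> 2 * n"
    using sub fin by (simp add: card_Diff_subset)
  moreover have "fst ` C \<noteq> {1..n}" "snd ` C \<noteq> {1..n}"
    using outside[OF w] by auto
  ultimately have "admissible n (fst ` C) (snd ` C)"
    using inside sub C(1) by (auto simp: admissible_def)
  moreover have "cross {1..n} {1..n} (fst ` C) (snd ` C) \<subseteq> S"
  \<comment> \<open>A cell of the cross uses a row or a column of \<open>C\<close> but not both. So
    it is not in \<open>C\<close>, and \<open>closed'\<close> forces it into
    \<open>S\<close>.\<close>
  proof
    fix x assume "x \<in> cross {1..n} {1..n} (fst ` C) (snd ` C)"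
    then have "fst x \<in> fst ` C \<and> snd x \<in> {1..n} - snd ` C \<or>
        fst x \<in> {1..n} - fst ` C \<and> snd x \<in> snd ` C"
      unfolding cross_def Un_iff mem_Times_iff .
    then have "x \<in> ?V" "fst x \<in> fst ` C \<or> snd x \<in> snd ` C" "x \<notin> C"
      using sub unfolding mem_Times_iff by blast+
    then show "x \<in> S" using closed'[of x] by blast
  qed
  ultimately show ?thesis by (rule that)
qed

section \<open>Crosses as disconnecting sets\<close>

lemma rectangle_neighbour:
  assumes "u \<in> R \<times> D" "3 \<le> card R + card D"
  obtains v where "v \<in> R \<times> D" "v \<noteq> u" "fst u = fst v \<or> snd u = snd v"
proof -
  obtain x y where u: "u = (x, y)" "x \<in> R" "y \<in> D" using assms by auto
  have "\<not> (R \<subseteq> {x} \<and> D \<subseteq> {y})"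
    using assms(2) card_mono[of "{x}" R] card_mono[of "{y}" D] by auto
  then consider x' where "x' \<in> R" "x' \<noteq> x" | y' where "y' \<in> D" "y' \<noteq> y" by blast
  then show ?thesis
  proof cases
    case 1
    then show ?thesis using u by (intro that[of "(x', y)"]) auto
  next
    case 2
    then show ?thesis using u by (intro that[of "(x, y')"]) auto
  qed
qed

text \<open>Deleting the cross leaves two rectangles sharing neither a row nor a column, so
  \<open>R \<times> D\<close> is closed. Admissibility gives every cell a neighbour within its own
  rectangle.\<close>

lemma disconnecting_set2_cross:
  assumes "admissible n R D"
  shows "disconnecting_set2 (lattice_graph n) (cross {1..n} {1..n} R D)"
proof -
  let ?N = "{1..n}"
  let ?X = "cross ?N ?N R D"
  have RD: "R \<subset> ?N" "D \<subset> ?N" "R \<noteq> {}" "D \<noteq> {}" "3 \<le> card R + card D"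
    "card R + card D + 3 \<le> 2 * n"
    using assms by (auto simp: admissible_def)
  then have "finite R" "finite D" by (auto intro: finite_subset)
  with RD have compl: "3 \<le> card (?N - R) + card (?N - D)"
    by (auto simp: card_Diff_subset psubset_imp_subset)
  have rest: "?N \<times> ?N - ?X = R \<times> D \<union> (?N - R) \<times> (?N - D)"
    using RD by (auto simp: cross_def)
  have nb: "\<exists>v \<in> ?N \<times> ?N - ?X. u \<rightarrow>\<^bsub>lattice_graph n\<^esub> v" if "u \<in> ?N \<times> ?N - ?X" for u
  proof -
    have "u \<in> R \<times> D \<or> u \<in> (?N - R) \<times> (?N - D)"
      using that rest by blast
    then obtain v where "v \<in> R \<times> D \<union> (?N - R) \<times> (?N - D)" "v \<noteq> u"
      "fst u = fst v \<or> snd u = snd v"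
      using rectangle_neighbour[of u R D] rectangle_neighbour[of u "?N - R" "?N - D"] RD compl
      by (metis UnCI)
    then show ?thesis
      using that unfolding rest[symmetric] dominates_lattice_graph by blast
  qed
  have "R \<times> D \<noteq> {}" "R \<times> D \<subset> ?N \<times> ?N - ?X"
    using RD unfolding rest by blast+
  moreover have "\<forall>u \<in> R \<times> D. \<forall>v \<in> ?N \<times> ?N - ?X. u \<rightarrow>\<^bsub>lattice_graph n\<^esub> v \<longrightarrow> v \<in> R \<times> D"
    unfolding rest dominates_lattice_graph by auto
  moreover have "?X \<subseteq> ?N \<times> ?N" using RD by (auto simp: cross_def)
  moreover have "\<forall>u \<in> ?N \<times> ?N - ?X. \<exists>v \<in> ?N \<times> ?N - ?X. u \<rightarrow>\<^bsub>lattice_graph n\<^esub> v"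
    using nb by (rule ballI)
  ultimately show ?thesis
    unfolding disconnecting_set2_iff[OF graph_lattice_graph] verts_lattice_graph
    by (intro conjI exI[of _ "R \<times> D"])
qed

section \<open>The minimum size of a cross and the equality cases\<close>

lemma rectangle_count:
  fixes a b n :: int
  assumes "3 \<le> a + b" "a + b + 3 \<le> 2 * n"
  shows "3 * n - 4 \<le> a * (n - b) + (n - a) * b"
    and "a * (n - b) + (n - a) * b = 3 * n - 4 \<Longrightarrow>
      a + b = 3 \<and> \<bar>a - b\<bar> = 1 \<or> a + b = 2 * n - 3 \<and> \<bar>a - b\<bar> = 1 \<or> n = 4 \<and> a = 2 \<and> b = 2"
proof -
  let ?f = "a * (n - b) + (n - a) * b"
  have f: "2 * ?f = (a + b) * (2 * n - (a + b)) + (a - b)\<^sup>2"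
    by (simp add: algebra_simps power2_eq_square)
  consider "a + b = 3 \<or> a + b = 2 * n - 3" | "4 \<le> a + b" "a + b + 4 \<le> 2 * n"
    using assms by linarith
  then have "3 * n - 4 \<le> ?f \<and> (?f = 3 * n - 4 \<longrightarrow>
      a + b = 3 \<and> \<bar>a - b\<bar> = 1 \<or> a + b = 2 * n - 3 \<and> \<bar>a - b\<bar> = 1 \<or> n = 4 \<and> a = 2 \<and> b = 2)"
  proof cases
    case 1
    \<comment> \<open>Parity: both \<open>3\<close> and \<open>2 * n - 3\<close> are odd.\<close>
    then have "a \<noteq> b" by presburger
    then have "1 \<le> (a - b)\<^sup>2" by (simp add: int_one_le_iff_zero_less)
    moreover have "(a + b) * (2 * n - (a + b)) = 3 * (2 * n - 3)"
      using 1 by (elim disjE) simp_all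
    moreover have "\<bar>a - b\<bar> = 1" if "(a - b)\<^sup>2 = 1"
      using that by (auto simp: power2_eq_1_iff)
    ultimately show ?thesis using f 1 by auto
  next
    case 2
    \<comment> \<open>With \<open>s = a + b\<close> and \<open>t = 2 * n - s\<close>, expanding
      \<open>(s - 4) * (t - 4) \<ge> 0\<close> and using \<open>s + t = 2 * n\<close> bounds
      \<open>s * t\<close> below by a linear term.\<close>
    have "0 \<le> (a + b - 4) * (2 * n - (a + b) - 4)"
      using 2 by (intro mult_nonneg_nonneg) auto
    then have g: "8 * n - 16 \<le> (a + b) * (2 * n - (a + b))"
      by (simp add: algebra_simps)
    \<comment> \<open>Naming the nonlinear terms leaves linear arithmetic:
      \<open>8 * n - 16 \<ge> 6 * n - 8\<close> for \<open>n \<ge> 4\<close>, with equality only at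
      \<open>n = 4\<close>.\<close>
    define f P Q where abs: "f = ?f" "P = (a + b) * (2 * n - (a + b))" "Q = (a - b)\<^sup>2"
    have "2 * f = P + Q" "8 * n - 16 \<le> P" "0 \<le> Q" "4 \<le> n"
      using f g 2 by (simp_all add: abs)
    then have "3 * n - 4 \<le> f \<and> (f = 3 * n - 4 \<longrightarrow> n = 4 \<and> Q = 0)" by linarith
    moreover have "a = 2 \<and> b = 2" if "n = 4" "Q = 0"
      using that 2 by (simp add: abs)
    ultimately show ?thesis unfolding abs(1) by blast
  qed
  then show "3 * n - 4 \<le> ?f" and "?f = 3 * n - 4 \<Longrightarrow>
      a + b = 3 \<and> \<bar>a - b\<bar> = 1 \<or> a + b = 2 * n - 3 \<and> \<bar>a - b\<bar> = 1 \<or> n = 4 \<and> a = 2 \<and> b = 2"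
    by blast+
qed

lemma card_cross_admissible:
  assumes "admissible n R D"
  shows "3 * n - 4 \<le> card (cross {1..n} {1..n} R D)"
    and "card (cross {1..n} {1..n} R D) = 3 * n - 4 \<Longrightarrow>
      card R = 1 \<and> card D = 2 \<or> card R = 2 \<and> card D = 1 \<or>
      card ({1..n} - R) = 1 \<and> card ({1..n} - D) = 2 \<or>
      card ({1..n} - R) = 2 \<and> card ({1..n} - D) = 1 \<or>
      n = 4 \<and> card R = 2 \<and> card D = 2"
proof -
  have RD: "R \<subseteq> {1..n}" "D \<subseteq> {1..n}" "3 \<le> card R + card D" "card R + card D + 3 \<le> 2 * n"
    using assms by (auto simp: admissible_def)
  then have fin: "finite R" "finite D" by (auto intro: finite_subset)
  have le: "card R \<le> n" "card D \<le> n"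
    using RD card_mono[of "{1..n}"] by fastforce+
  \<comment> \<open>The count is moved to the integers, where \<open>n - card D\<close> and
    \<open>n - card R\<close> are not truncated.\<close>
  have card_int: "int (card (cross {1..n} {1..n} R D)) =
      int (card R) * (int n - int (card D)) + (int n - int (card R)) * int (card D)"
    using le card_cross[OF _ _ RD(1,2)] by (simp add: of_nat_diff)
  have compl: "card ({1..n} - R) = n - card R" "card ({1..n} - D) = n - card D"
    using RD fin by (simp_all add: card_Diff_subset)
  have n: "3 \<le> n" using RD by linarith
  note count = rectangle_count[of "int (card R)" "int (card D)" "int n", folded card_int]
  show "3 * n - 4 \<le> card (cross {1..n} {1..n} R D)"
    using count(1) RD by linarith
  assume "card (cross {1..n} {1..n} R D) = 3 * n - 4"
  then have "int (card (cross {1..n} {1..n} R D)) = 3 * int n - 4"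
    using n by linarith
  then consider "int (card R) + int (card D) = 3" "\<bar>int (card R) - int (card D)\<bar> = 1"
    | "int (card R) + int (card D) = 2 * int n - 3" "\<bar>int (card R) - int (card D)\<bar> = 1"
    | "int n = 4" "int (card R) = 2" "int (card D) = 2"
    using count(2) RD(3,4) by linarith
  then show "card R = 1 \<and> card D = 2 \<or> card R = 2 \<and> card D = 1 \<or>
      card ({1..n} - R) = 1 \<and> card ({1..n} - D) = 2 \<or>
      card ({1..n} - R) = 2 \<and> card ({1..n} - D) = 1 \<or>
      n = 4 \<and> card R = 2 \<and> card D = 2"
  proof cases
    case 1
    then have "card R = 1 \<and> card D = 2 \<or> card R = 2 \<and> card D = 1" by linarith
    then show ?thesis by blast
  \<comment> \<open>The sum \<open>2 * n - 3\<close> says that the complements have sizes summing to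
    \<open>3\<close>.\<close>
  next
    case 2
    then have "card ({1..n} - R) = 1 \<and> card ({1..n} - D) = 2 \<or>
        card ({1..n} - R) = 2 \<and> card ({1..n} - D) = 1"
      unfolding compl using le by linarith
    then show ?thesis by blast
  next
    case 3
    then show ?thesis by simp
  qed
qed

section \<open>Extremal crosses as neighbourhoods of edges\<close>

lemma neighbourhood_eq_cross:
  assumes "u \<rightarrow>\<^bsub>lattice_graph n\<^esub> v"
  shows "neighbourhood (lattice_graph n) {u, v} =
    cross {1..n} {1..n} {fst u, fst v} {snd u, snd v}"
proof -
  obtain a b x y where uv: "u = (a, b)" "v = (x, y)" by (metis surj_pair)
  have ab: "a \<in> {1..n}" "b \<in> {1..n}" "x \<in> {1..n}" "y \<in> {1..n}" "a = x \<or> b = y"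
    using assms unfolding dominates_lattice_graph uv by auto
  have nbh: "(p, q) \<in> neighbourhood (lattice_graph n) {u, v} \<longleftrightarrow>
      p \<in> {1..n} \<and> q \<in> {1..n} \<and> (p, q) \<noteq> (a, b) \<and> (p, q) \<noteq> (x, y) \<and>
      (p = a \<or> q = b \<or> p = x \<or> q = y)" for p q
    unfolding neighbourhood_def dominates_lattice_graph verts_lattice_graph uv using ab(1-4) by auto
  have crs: "(p, q) \<in> cross {1..n} {1..n} {a, x} {b, y} \<longleftrightarrow>
      p \<in> {1..n} \<and> q \<in> {1..n} \<and>
      ((p = a \<or> p = x) \<and> q \<noteq> b \<and> q \<noteq> y \<or> p \<noteq> a \<and> p \<noteq> x \<and> (q = b \<or> q = y))" for p q
    unfolding cross_def using ab(1-4) by auto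
  \<comment> \<open>Since \<open>u\<close> and \<open>v\<close> share a row or a column, they are
    the only cells of the rectangle spanned by their rows and columns. Every other cell sharing a
    line with one of them thus lies in exactly one of these rows and columns.\<close>
  show ?thesis
  proof (rule set_eqI)
    fix z :: "nat \<times> nat"
    obtain p q where z: "z = (p, q)" by (metis surj_pair)
    show "z \<in> neighbourhood (lattice_graph n) {u, v} \<longleftrightarrow>
        z \<in> cross {1..n} {1..n} {fst u, fst v} {snd u, snd v}"
      using ab(5) unfolding z nbh unfolding uv fst_conv snd_conv crs by (elim disjE) auto
  qed
qed

text \<open>The two cells of a 1 by 2 or 2 by 1 rectangle form an edge whose coordinates recover
  \<open>R\<close> and \<open>D\<close>.\<close>

lemma cross_eq_neighbourhood:
  assumes "R \<subseteq> {1..n}" "D \<subseteq> {1..n}" "card R = 1 \<and> card D = 2 \<or> card R = 2 \<and> card D = 1"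
  shows "\<exists>u v. u \<rightarrow>\<^bsub>lattice_graph n\<^esub> v \<and>
    cross {1..n} {1..n} R D = neighbourhood (lattice_graph n) {u, v}"
proof -
  obtain u v where "u \<rightarrow>\<^bsub>lattice_graph n\<^esub> v" "R = {fst u, fst v}" "D = {snd u, snd v}"
    using assms(3)
  proof
    assume card: "card R = 1 \<and> card D = 2"
    obtain x where "R = {x}" using card card_1_singletonE by blast
    moreover obtain y z where "D = {y, z}" "y \<noteq> z" using card card_2_iff by metis
    ultimately show ?thesis
      using assms(1,2) by (intro that[of "(x, y)" "(x, z)"]) (auto simp: parcs_lattice_graph_iff)
  next
    assume card: "card R = 2 \<and> card D = 1"
    obtain x where "D = {x}" using card card_1_singletonE by blast
    moreover obtain y z where "R = {y, z}" "y \<noteq> z" using card card_2_iff by metis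
    ultimately show ?thesis
      using assms(1,2) by (intro that[of "(y, x)" "(z, x)"]) (auto simp: parcs_lattice_graph_iff)
  qed
  then show ?thesis using neighbourhood_eq_cross by metis
qed

lemma cross_of_edge:
  assumes "n \<ge> 3" "u \<rightarrow>\<^bsub>lattice_graph n\<^esub> v"
  shows "admissible n {fst u, fst v} {snd u, snd v}"
    and "card (cross {1..n} {1..n} {fst u, fst v} {snd u, snd v}) = 3 * n - 4"
proof -
  have uv: "{fst u, fst v} \<subseteq> {1..n}" "{snd u, snd v} \<subseteq> {1..n}"
    "card {fst u, fst v} = 1 \<and> card {snd u, snd v} = 2 \<or>
     card {fst u, fst v} = 2 \<and> card {snd u, snd v} = 1"
    using assms(2) unfolding dominates_lattice_graph
    by (auto simp: card_insert_if prod_eq_iff)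
  moreover have "X \<noteq> {1..n}" if "card X \<le> 2" for X
    using that assms(1) by auto
  ultimately show "admissible n {fst u, fst v} {snd u, snd v}"
    using assms(1) unfolding admissible_def by auto
  \<comment> \<open>In either orientation the count is \<open>(n - 2) + 2 * (n - 1)\<close>.\<close>
  show "card (cross {1..n} {1..n} {fst u, fst v} {snd u, snd v}) = 3 * n - 4"
    unfolding card_cross[OF finite_atLeastAtMost finite_atLeastAtMost uv(1,2)]
    using uv(3) assms(1) by auto
qed

text \<open>Bijections \<open>X\<close> to \<open>Y\<close> and \<open>A - X\<close> to
  \<open>A - Y\<close> are glued and extended by the identity. This brings any two rows or columns
  into the position \<open>{1, 2}\<close>.\<close>

lemma permutes_image_subset_exists:
  assumes "finite A" "X \<subseteq> A" "Y \<subseteq> A" "card X = card Y"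
  obtains p where "p permutes A" "p ` X = Y"
proof -
  have fin: "finite X" "finite Y" using assms finite_subset by blast+
  obtain f where f: "bij_betw f X Y"
    using finite_same_card_bij[OF fin assms(4)] by blast
  obtain g where g: "bij_betw g (A - X) (A - Y)"
    using finite_same_card_bij[of "A - X" "A - Y"] assms fin by (auto simp: card_Diff_subset)
  define p where "p x = (if x \<in> X then f x else if x \<in> A then g x else x)" for x
  have "bij_betw p X Y" "bij_betw p (A - X) (A - Y)"
    using f g bij_betw_cong[of X p f] bij_betw_cong[of "A - X" p g] by (simp_all add: p_def)
  moreover from this have "bij_betw p (X \<union> (A - X)) (Y \<union> (A - Y))"
    by (intro bij_betw_combine) auto
  moreover have "X \<union> (A - X) = A" "Y \<union> (A - Y) = A" using assms by auto
  ultimately have "bij_betw p A A" "p ` X = Y" by (auto simp: bij_betw_def)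
  moreover from this have "p permutes A"
    using assms(2) by (intro bij_imp_permutes) (auto simp: p_def)
  ultimately show ?thesis using that by blast
qed

section \<open>The minimum value and the classification of minimum sets\<close>

theorem lemma8p1:
  fixes n k l :: nat
  assumes "n \<ge> 3" and "k = 2 * (n - 1)" and "l = n - 2"
  shows "kappa2 (lattice_graph n) = 2 * k - l - 2 \<and>
    2 * k - l - 2 = 3 * n - 4 \<and>
    (\<forall>S. disconnecting_set2 (lattice_graph n) S \<and> card S = 3 * n - 4 \<longleftrightarrow>
      (\<exists>u v. u \<rightarrow>\<^bsub>lattice_graph n\<^esub> v \<and> S = neighbourhood (lattice_graph n) {u, v}) \<or>
      n = 4 \<and> (\<exists>\<sigma> \<tau>. \<sigma> permutes {1..n} \<and> \<tau> permutes {1..n} \<and>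
        S = map_prod \<sigma> \<tau> `
          {(1, 3), (1, 4), (2, 3), (2, 4), (3, 2), (3, 1), (4, 2), (4, 1)}))"
proof -
  let ?L = "with_proj (lattice_graph n)"
  let ?N = "{1..n}"
  let ?Q = "{(1, 3), (1, 4), (2, 3), (2, 4), (3, 2), (3, 1), (4, 2), (4, 1)} :: (nat \<times> nat) set"
  have arith: "2 * k - l - 2 = 3 * n - 4"
    using assms by simp
  have S_lower: "3 * n - 4 \<le> card S" if S: "disconnecting_set2 ?L S" for S
  proof -
    obtain R D where RD: "admissible n R D" "cross ?N ?N R D \<subseteq> S"
      using disconnecting_set2_superset_cross[OF S] .
    moreover have "finite S"
      using S by (rule finite_disconnecting_set2_lattice_graph)
    ultimately have "card (cross ?N ?N R D) \<le> card S"
      by (intro card_mono)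
    with card_cross_admissible(1)[OF RD(1)] show ?thesis by (rule le_trans)
  qed
  \<comment> \<open>The exceptional set is what separates two complementary 2 by 2 blocks of the 4
    by 4 grid.\<close>
  have Q_cross: "?Q = cross {1..4} {1..4} {1, 2} {1, 2}"
  proof -
    have "{1..4} - {1, 2} = {3, 4::nat}" by auto
    then show ?thesis unfolding cross_def by auto
  qed
  have edge: "disconnecting_set2 ?L (neighbourhood ?L {u, v}) \<and>
      card (neighbourhood ?L {u, v}) = 3 * n - 4" if "u \<rightarrow>\<^bsub>?L\<^esub> v" for u v
    using cross_of_edge[OF assms(1) that] disconnecting_set2_cross
    by (simp add: neighbourhood_eq_cross[OF that])
  have ex: "disconnecting_set2 ?L (map_prod \<sigma> \<tau> ` ?Q) \<and> card (map_prod \<sigma> \<tau> ` ?Q) = 3 * n - 4"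
    if n: "n = 4" and perm: "\<sigma> permutes ?N" "\<tau> permutes ?N" for \<sigma> \<tau>
  proof -
    have sub: "{1, 2} \<subseteq> ?N" using n by auto
    have Q: "map_prod \<sigma> \<tau> ` ?Q = cross ?N ?N (\<sigma> ` {1, 2}) (\<tau> ` {1, 2})"
      using map_prod_image_cross[OF perm[THEN permutes_imp_bij] sub sub] n
      unfolding Q_cross by simp
    have "inj \<sigma>" "inj \<tau>" using perm by (auto dest: permutes_inj)
    then have card: "card (\<sigma> ` {1, 2}) = 2" "card (\<tau> ` {1, 2}) = 2"
      by (simp_all add: card_insert_if inj_eq)
    moreover have img: "\<sigma> ` {1, 2} \<subseteq> ?N" "\<tau> ` {1, 2} \<subseteq> ?N"
      using perm sub by (metis image_mono permutes_image)+
    ultimately have "admissible n (\<sigma> ` {1, 2}) (\<tau> ` {1, 2})"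
      unfolding admissible_def using n by force
    then show ?thesis
      unfolding Q using disconnecting_set2_cross card_cross[OF _ _ img] card n by simp
  qed
  have classify: "(\<exists>u v. u \<rightarrow>\<^bsub>?L\<^esub> v \<and> S = neighbourhood ?L {u, v}) \<or>
      n = 4 \<and> (\<exists>\<sigma> \<tau>. \<sigma> permutes ?N \<and> \<tau> permutes ?N \<and> S = map_prod \<sigma> \<tau> ` ?Q)"
    if S: "disconnecting_set2 ?L S" "card S = 3 * n - 4" for S
  proof -
    obtain R D where RD: "admissible n R D" "cross ?N ?N R D \<subseteq> S"
      using disconnecting_set2_superset_cross[OF S(1)] .
    have "finite S"
      using S(1) by (rule finite_disconnecting_set2_lattice_graph)
    \<comment> \<open>The contained cross already has at least \<open>card S\<close> cells, so it is
      all of \<open>S\<close>.\<close>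
    then have eq: "S = cross ?N ?N R D"
      using card_cross_admissible(1)[OF RD(1)] RD(2) S(2) by (metis card_seteq)
    have sub: "R \<subseteq> ?N" "D \<subseteq> ?N" using RD(1) by (auto simp: admissible_def)
    consider "card R = 1 \<and> card D = 2 \<or> card R = 2 \<and> card D = 1"
      | "card (?N - R) = 1 \<and> card (?N - D) = 2 \<or> card (?N - R) = 2 \<and> card (?N - D) = 1"
      | "n = 4" "card R = 2" "card D = 2"
      using card_cross_admissible(2)[OF RD(1)] S(2) unfolding eq by blast
    then show ?thesis
    proof cases
      case 1
      then show ?thesis using cross_eq_neighbourhood[OF sub] eq by blast
    next
      case 2
      \<comment> \<open>The complementary pair has the same cross and is spanned by an edge.\<close>
      then show ?thesis
        using cross_eq_neighbourhood[of "?N - R" n "?N - D"] cross_compl[OF sub] eq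
        by (metis Diff_subset)
    next
      case 3
      have sub12: "{1, 2} \<subseteq> ?N" using 3 by auto
      obtain \<sigma> where \<sigma>: "\<sigma> permutes ?N" "\<sigma> ` {1, 2} = R"
        by (rule permutes_image_subset_exists[OF _ sub12 sub(1)]) (use 3 in auto)
      obtain \<tau> where \<tau>: "\<tau> permutes ?N" "\<tau> ` {1, 2} = D"
        by (rule permutes_image_subset_exists[OF _ sub12 sub(2)]) (use 3 in auto)
      have "map_prod \<sigma> \<tau> ` cross ?N ?N {1, 2} {1, 2} = cross ?N ?N (\<sigma> ` {1, 2}) (\<tau> ` {1, 2})"
        by (intro map_prod_image_cross permutes_imp_bij \<sigma>(1) \<tau>(1) sub12)
      then have "S = map_prod \<sigma> \<tau> ` ?Q"
        unfolding Q_cross eq \<sigma>(2) \<tau>(2) 3(1) by simp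
      then show ?thesis using 3(1) \<sigma>(1) \<tau>(1) by blast
    qed
  qed
  \<comment> \<open>Any edge shows that the lower bound is attained.\<close>
  have "(1, 1) \<rightarrow>\<^bsub>?L\<^esub> (1, 2)"
    using assms(1) by (simp add: parcs_lattice_graph_iff)
  from edge[OF this] have "kappa2 ?L = 3 * n - 4"
    unfolding kappa2_def using S_lower by (intro Least_equality) blast+
  moreover have "disconnecting_set2 ?L S \<and> card S = 3 * n - 4 \<longleftrightarrow>
      (\<exists>u v. u \<rightarrow>\<^bsub>?L\<^esub> v \<and> S = neighbourhood ?L {u, v}) \<or>
      n = 4 \<and> (\<exists>\<sigma> \<tau>. \<sigma> permutes ?N \<and> \<tau> permutes ?N \<and> S = map_prod \<sigma> \<tau> ` ?Q)" for S
    using classify[of S] edge ex by metis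
  ultimately show ?thesis
    using arith by simp
qed

end
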